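(* Let $T$ be a trapezoid in the Euclidean plane with vertices $\mathbf{p},\mathbf{q},\mathbf{r},\mathbf{s}$, in counterclockwise order. Suppose that $T$ is dissected into $n$ triangles of areas $a_1,\dots,a_n$. Then the area of the triangle $\mathbf{p}\mathbf{q}\mathbf{s}$ is integral over the ring $\mathbb{Z}[a_1,\dots,a_n]\subset\mathbb{R}$.
   Context: A dissection of a plane polygon $T$ into triangles is a (finite) collection of (nondegenerate) triangles in the plane whose union is $T$ and whose interiors are pairwise disjoint; the triangles are not required to meet edge to edge. A trapezoid is a quadrilateral with at least one pair of parallel sides (so parallelograms are trapezoids). Areas here are ordinary (positive) Euclidean areas. $\mathbb{Z}[a_1,\dots,a_n]$ is the subring of $\mathbb{R}$ generated by $a_1,\dots,a_n$. *)

theory Defs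
  imports "HOL-Analysis.Analysis" "HOL-Computational_Algebra.Polynomial"
begin

definition is_triangle :: "(real^2) set \<Rightarrow> bool" where
  "is_triangle \<Delta> \<longleftrightarrow> (\<exists>u v w. \<not> collinear {u, v, w} \<and> \<Delta> = convex hull {u, v, w})"

definition dissection :: "(real^2) set \<Rightarrow> nat \<Rightarrow> (nat \<Rightarrow> (real^2) set) \<Rightarrow> bool" where
  "dissection T n \<Delta> \<longleftrightarrow>
     (\<forall>i\<in>{1..n}. is_triangle (\<Delta> i)) \<and>
     (\<Union>i\<in>{1..n}. \<Delta> i) = T \<and>
     (\<forall>i\<in>{1..n}. \<forall>j\<in>{1..n}. i \<noteq> j \<longrightarrow> interior (\<Delta> i) \<inter> interior (\<Delta> j) = {})"

definition ccw :: "real^2 \<Rightarrow> real^2 \<Rightarrow> real^2 \<Rightarrow> bool" where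
  "ccw u v w \<longleftrightarrow> (v$1 - u$1) * (w$2 - u$2) - (v$2 - u$2) * (w$1 - u$1) > 0"

text \<open>
  Four strict left turns say exactly that the four points are the vertices, in
  counterclockwise order, of a nondegenerate convex quadrilateral: the exterior angles lie
  strictly between 0 and \<open>\<pi>\<close> and sum to a multiple of \<open>2\<pi>\<close> that is less than \<open>4\<pi>\<close>.
  Convexity is no restriction for trapezoids, since a (simple) quadrilateral with two
  parallel sides is convex.  The region it bounds is the convex hull of its vertices.
\<close>

definition ccw_quadrilateral :: "real^2 \<Rightarrow> real^2 \<Rightarrow> real^2 \<Rightarrow> real^2 \<Rightarrow> bool" where
  "ccw_quadrilateral p q r s \<longleftrightarrow> ccw p q r \<and> ccw q r s \<and> ccw r s p \<and> ccw s p q"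

definition parallel :: "real^2 \<Rightarrow> real^2 \<Rightarrow> bool" where
  "parallel x y \<longleftrightarrow> collinear {0, x, y}"

definition ccw_trapezoid :: "real^2 \<Rightarrow> real^2 \<Rightarrow> real^2 \<Rightarrow> real^2 \<Rightarrow> bool" where
  "ccw_trapezoid p q r s \<longleftrightarrow>
     ccw_quadrilateral p q r s \<and> (parallel (q - p) (r - s) \<or> parallel (r - q) (s - p))"

definition is_subring :: "'a::ring_1 set \<Rightarrow> bool" where
  "is_subring A \<longleftrightarrow> 1 \<in> A \<and> (\<forall>x\<in>A. \<forall>y\<in>A. x - y \<in> A \<and> x * y \<in> A)"

text \<open>Modelled on \<^const>\<open>algebraic_int\<close>, which is the case where \<open>A\<close> is \<open>\<int>\<close>.\<close>

definition integral_over :: "'a::comm_ring_1 set \<Rightarrow> 'a \<Rightarrow> bool" where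
  "integral_over A x \<longleftrightarrow> (\<exists>f. lead_coeff f = 1 \<and> (\<forall>i. coeff f i \<in> A) \<and> poly f x = 0)"

end

theory Submission imports Defs begin

text \<open>
  This is Monsky's argument with the 2-adic valuation replaced by a valuation ring \<open>V\<close> of \<open>\<real>\<close>
  (with arbitrary value group). If the area \<open>A\<close> of \<open>pqs\<close> were not integral over
  \<open>\<int>[a\<^sub>1, \<dots>, a\<^sub>n]\<close>, some \<open>V\<close> would contain all the \<open>a\<^sub>i\<close> but not \<open>A\<close>. Take affine coordinates
  with \<open>p = (0,0)\<close>, \<open>q = (1,0)\<close>, \<open>s = (0,1)\<close>, so that \<open>r = (\<lambda>,1)\<close> or \<open>r = (1,\<lambda>)\<close>, and colour
  the plane by comparing \<open>\<bar>x\<bar>\<close>, \<open>\<bar>y\<bar>\<close> and \<open>1\<close>. A triangle with three different colours has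
  \<open>a\<^sub>i / A\<close> of absolute value at least 1, hence \<open>A \<in> V\<close>; and no line carries all three colours.

  Sperner's lemma is replaced by a telescoping statement. Let \<open>\<phi> u v\<close> count the segment from
  \<open>u\<close> to \<open>v\<close> as \<open>1\<close>, \<open>-1\<close> or \<open>0\<close> according to its end colours. Since lines miss a colour, \<open>\<phi>\<close> is
  additive along every line, and such a \<open>\<phi>\<close> has the same total over the boundaries of the pieces as
  over the boundary of \<open>T\<close>: on each line, the jump of the indicator functions across that line
  shows that the directed edges of all pieces cancel except for those of \<open>T\<close>. The total is \<open>1\<close> for
  \<open>T\<close> and \<open>0\<close> for every triangle that does not have three colours.
\<close>

section \<open>Valuation rings\<close>

lemma is_subring_zero: "is_subring S \<Longrightarrow> 0 \<in> S"
  unfolding is_subring_def by (metis diff_self)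

lemma is_subring_diff: "is_subring S \<Longrightarrow> x \<in> S \<Longrightarrow> y \<in> S \<Longrightarrow> x - y \<in> S"
  unfolding is_subring_def by blast

lemma is_subring_mult: "is_subring S \<Longrightarrow> x \<in> S \<Longrightarrow> y \<in> S \<Longrightarrow> x * y \<in> S"
  unfolding is_subring_def by blast

lemma is_subring_one: "is_subring S \<Longrightarrow> 1 \<in> S"
  unfolding is_subring_def by blast

lemma is_subring_uminus: "is_subring S \<Longrightarrow> x \<in> S \<Longrightarrow> - x \<in> S"
  using is_subring_diff[OF _ is_subring_zero] by fastforce

lemma is_subring_add: "is_subring S \<Longrightarrow> x \<in> S \<Longrightarrow> y \<in> S \<Longrightarrow> x + y \<in> S"
  using is_subring_diff[of S x "- y"] is_subring_uminus[of S y] by simp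

lemma is_subring_sum: "is_subring S \<Longrightarrow> (\<And>i. i \<in> I \<Longrightarrow> f i \<in> S) \<Longrightarrow> sum f I \<in> S"
  by (induction I rule: infinite_finite_induct) (auto simp: is_subring_zero is_subring_add)

lemma is_subring_power: "is_subring S \<Longrightarrow> x \<in> S \<Longrightarrow> x ^ k \<in> S"
  by (induction k) (auto simp: is_subring_one is_subring_mult)

lemmas is_subring_closed =
  is_subring_zero is_subring_one is_subring_diff is_subring_mult is_subring_uminus
  is_subring_add is_subring_sum is_subring_power

lemma is_subring_hull: "is_subring (is_subring hull X)"
  unfolding hull_def is_subring_def by blast

definition coeffs_in :: "'a::comm_ring_1 set \<Rightarrow> 'a poly \<Rightarrow> bool" where
  "coeffs_in S f \<longleftrightarrow> (\<forall>i. coeff f i \<in> S)"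

text \<open>The ring \<open>S[y]\<close>, described by values of polynomials so that the degree of a
  representation is at hand.\<close>

definition adjoin :: "'a::comm_ring_1 set \<Rightarrow> 'a \<Rightarrow> 'a set" where
  "adjoin S y = {poly f y | f. coeffs_in S f}"

context
  fixes S :: "'a::comm_ring_1 set"
  assumes S: "is_subring S"
begin

lemma coeffs_in_diff: "coeffs_in S f \<Longrightarrow> coeffs_in S g \<Longrightarrow> coeffs_in S (f - g)"
  using S by (simp add: coeffs_in_def is_subring_closed)

lemma coeffs_in_add: "coeffs_in S f \<Longrightarrow> coeffs_in S g \<Longrightarrow> coeffs_in S (f + g)"
  using S by (simp add: coeffs_in_def is_subring_closed)

lemma coeffs_in_mult: "coeffs_in S f \<Longrightarrow> coeffs_in S g \<Longrightarrow> coeffs_in S (f * g)"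
  using S by (simp add: coeffs_in_def coeff_mult is_subring_closed)

lemma coeffs_in_smult: "c \<in> S \<Longrightarrow> coeffs_in S g \<Longrightarrow> coeffs_in S (smult c g)"
  using S by (simp add: coeffs_in_def is_subring_closed)

lemma coeffs_in_monom: "c \<in> S \<Longrightarrow> coeffs_in S (monom c k)"
  using S by (simp add: coeffs_in_def is_subring_closed)

lemma coeffs_in_reflect: "coeffs_in S g \<Longrightarrow> coeffs_in S (reflect_poly g)"
  using S by (simp add: coeffs_in_def coeff_reflect_poly is_subring_closed)

lemma adjoin_superset: "S \<subseteq> adjoin S y"
proof
  fix c assume "c \<in> S"
  then show "c \<in> adjoin S y"
    unfolding adjoin_def using coeffs_in_monom[of c 0] by (auto intro!: exI[of _ "monom c 0"] simp: poly_monom)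
qed

lemma adjoin_generator: "y \<in> adjoin S y"
  unfolding adjoin_def using coeffs_in_monom[OF is_subring_one[OF S], of 1]
  by (auto intro!: exI[of _ "monom 1 1"] simp: poly_monom)

lemma is_subring_adjoin: "is_subring (adjoin S y)"
  unfolding is_subring_def
proof (intro conjI ballI)
  show "1 \<in> adjoin S y" using adjoin_superset is_subring_one[OF S] by blast
  fix u v assume "u \<in> adjoin S y" "v \<in> adjoin S y"
  then obtain f g where "u = poly f y" "coeffs_in S f" "v = poly g y" "coeffs_in S g"
    unfolding adjoin_def by blast
  then show "u - v \<in> adjoin S y" "u * v \<in> adjoin S y"
    unfolding adjoin_def using coeffs_in_diff[of f g] coeffs_in_mult[of f g]
    by (force intro!: exI[of _ "f - g"], force intro!: exI[of _ "f * g"])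
qed

end

text \<open>Multiplying \<open>A = poly f (inverse A)\<close> by \<open>A ^ n\<close> turns it into
  \<open>A ^ Suc n = poly (reflect_poly f) A\<close>. The right side has degree at most
  \<open>n\<close>, so this is a monic relation for \<open>A\<close>.\<close>

lemma integral_over_if_in_adjoin_inverse:
  fixes A :: "'a::field"
  assumes R: "is_subring R" and A: "A \<noteq> 0" "A \<in> adjoin R (inverse A)"
  shows "integral_over R A"
proof -
  obtain f where f: "coeffs_in R f" "poly f (inverse A) = A"
    using A(2) unfolding adjoin_def mem_Collect_eq by metis
  define n where "n = degree f"
  define g where "g = monom 1 (Suc n) - reflect_poly f"
  have deg: "degree (reflect_poly f) < Suc n"
    using degree_reflect_poly_le[of f] by (simp add: n_def)
  have "coeffs_in R g"
    unfolding g_def using f R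
    by (intro coeffs_in_diff coeffs_in_monom coeffs_in_reflect) (auto simp: is_subring_one)
  moreover have "lead_coeff g = 1"
  proof -
    have "degree g = Suc n"
      unfolding g_def using deg degree_add_eq_left[of "- reflect_poly f" "monom 1 (Suc n)"]
      by (simp add: degree_monom_eq)
    then show ?thesis unfolding g_def using deg by (simp add: coeff_eq_0)
  qed
  moreover have "poly g A = 0"
    using A f by (simp add: g_def poly_monom poly_reflect_poly_nz n_def)
  ultimately show ?thesis
    unfolding integral_over_def coeffs_in_def by blast
qed

section \<open>Maximal subrings avoiding an element are valuation rings\<close>

definition valuation_ring :: "'a::field set \<Rightarrow> bool" where
  "valuation_ring V \<longleftrightarrow> is_subring V \<and> (\<forall>y. y \<in> V \<or> inverse y \<in> V)"

context
  fixes V :: "'a::field set" and A :: 'a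
  assumes V: "is_subring V" and A: "A \<notin> V" "inverse A \<in> V"
    and maximal: "\<And>S. is_subring S \<Longrightarrow> V \<subseteq> S \<Longrightarrow> A \<notin> S \<Longrightarrow> S = V"
begin

private lemma A_nz: "A \<noteq> 0"
  using A V is_subring_zero by blast

text \<open>If \<open>inverse w\<close> were outside \<open>V\<close>, maximality would give
  \<open>A\<close> in \<open>V[1/w]\<close>, and clearing denominators would put some
  \<open>w ^ k * A\<close> into \<open>V\<close>. But \<open>w ^ k = 1 - inverse A * t\<close> with
  \<open>t \<in> V\<close>, so \<open>w ^ k * A\<close> differs from \<open>A\<close> by
  \<open>t\<close>, and \<open>A\<close> itself would lie in \<open>V\<close>.\<close>

private lemma one_minus_unit:
  assumes b: "b \<in> V"
  defines "w \<equiv> 1 - inverse A * b"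
  shows "w \<noteq> 0" "inverse w \<in> V"
proof -
  have wV: "w \<in> V" unfolding w_def using V A b by (simp add: is_subring_closed)
  show nz: "w \<noteq> 0"
  proof
    assume "w = 0"
    then have "A = b" using A_nz by (simp add: w_def field_simps)
    with A b show False by simp
  qed
  have pow: "\<exists>t\<in>V. w ^ k = 1 - inverse A * t" for k
  proof (induction k)
    case 0 then show ?case using is_subring_zero[OF V] by (intro bexI[of _ 0]) auto
  next
    case (Suc k)
    then obtain t where t: "t \<in> V" "w ^ k = 1 - inverse A * t" by blast
    have "w ^ Suc k = 1 - inverse A * (b + t * w)"
      unfolding power_Suc t(2) by (simp add: w_def algebra_simps)
    then show ?case
      using t(1) b wV V by (blast intro: is_subring_add is_subring_mult)
  qed
  show "inverse w \<in> V"
  proof (rule ccontr)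
    assume "inverse w \<notin> V"
    then have "A \<in> adjoin V (inverse w)"
      using maximal[OF is_subring_adjoin[OF V] adjoin_superset[OF V]] adjoin_generator[OF V] by metis
    then obtain f where f: "coeffs_in V f" "poly f (inverse w) = A"
      unfolding adjoin_def by blast
    have "w ^ degree f * A = poly (reflect_poly f) w"
      using nz f by (simp add: poly_reflect_poly_nz)
    moreover have "poly (reflect_poly f) w \<in> V"
      using coeffs_in_reflect[OF V f(1)] V wV
      by (simp add: poly_altdef coeffs_in_def is_subring_closed)
    moreover obtain t where t: "t \<in> V" "w ^ degree f = 1 - inverse A * t" using pow by blast
    moreover have "A = w ^ degree f * A + t" unfolding t(2) using A_nz by (simp add: field_simps)
    ultimately show False using A V is_subring_add by metis
  qed
qed

text \<open>The bound \<open>n\<close> on the degree of a representation of \<open>A\<close> in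
  \<open>V[y]\<close> is the quantity lowered in the descent.\<close>

private definition rep :: "'a \<Rightarrow> nat \<Rightarrow> bool" where
  "rep y n \<longleftrightarrow> (\<exists>f. coeffs_in V f \<and> degree f \<le> n \<and> poly f y = A)"

text \<open>With \<open>b\<close> the constant term of \<open>g\<close>, the relation
  \<open>g(1/y) = A\<close> becomes \<open>A * w = g'(1/y) / y\<close>, where
  \<open>w = 1 - b / A\<close> is a unit of \<open>V\<close>. Multiplication by
  \<open>y ^ Suc n\<close> expresses that power through lower ones with coefficients in
  \<open>V\<close>, so the top term of \<open>f\<close> can be eliminated.\<close>

private lemma rep_step:
  assumes y: "y \<noteq> 0" and f: "rep y (Suc n)" and g: "rep (inverse y) m" and m: "m \<le> Suc n"
  shows "rep y n"
proof -
  obtain f where f: "coeffs_in V f" "degree f \<le> Suc n" "poly f y = A"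
    using f unfolding rep_def by blast
  obtain g where g: "coeffs_in V g" "degree g \<le> m" "poly g (inverse y) = A"
    using g unfolding rep_def by blast
  obtain b g' where g': "g = pCons b g'" by (cases g)
  have bV: "b \<in> V" using g(1) unfolding coeffs_in_def g' by (metis coeff_pCons_0)
  have g'V: "coeffs_in V g'" using g(1) unfolding coeffs_in_def g' by (metis coeff_pCons_Suc)
  have deg: "degree g' \<le> n"
    using g(2) m unfolding g' by (cases "g' = 0") (auto simp: degree_pCons_eq)
  define w where "w = 1 - inverse A * b"
  have w: "w \<noteq> 0" "inverse w \<in> V" using one_minus_unit[OF bV] by (simp_all add: w_def)
  \<comment> \<open>The monomial makes up for a degree of \<open>g'\<close> below \<open>n\<close>,
    so that \<open>h\<close> represents \<open>y ^ n * g'(1/y)\<close> in every case.\<close>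
  define h where "h = monom 1 (n - degree g') * reflect_poly g'"
  have hV: "coeffs_in V h"
    unfolding h_def using V g'V
    by (intro coeffs_in_mult coeffs_in_monom coeffs_in_reflect) (auto simp: is_subring_one)
  have hdeg: "degree h \<le> n"
  proof -
    have "degree h \<le> (n - degree g') + degree g'"
      unfolding h_def
      by (meson add_mono degree_monom_le degree_mult_le degree_reflect_poly_le le_trans)
    then show ?thesis using deg by simp
  qed
  have hy: "poly h y = y ^ n * poly g' (inverse y)"
  proof -
    have "poly h y = y ^ (n - degree g') * (y ^ degree g' * poly g' (inverse y))"
      using y by (simp add: h_def poly_monom poly_reflect_poly_nz)
    also have "\<dots> = y ^ n * poly g' (inverse y)"
      using deg by (simp flip: mult.assoc power_add)
    finally show ?thesis .
  qed
  have "A * w = inverse y * poly g' (inverse y)"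
    using g(3) A_nz by (auto simp: g' w_def field_simps)
  then have "poly h y = y ^ Suc n * (A * w)"
    using y hy by simp
  then have top: "y ^ Suc n = inverse A * inverse w * poly h y"
    using A_nz w(1) by (simp add: divide_simps)
  define c where "c = coeff f (Suc n)"
  define F where "F = (f - monom c (Suc n)) + smult (c * inverse A * inverse w) h"
  have cV: "c \<in> V" using f(1) by (simp add: c_def coeffs_in_def)
  have "coeffs_in V F"
    unfolding F_def using V f(1) cV hV A w
    by (intro coeffs_in_add coeffs_in_diff coeffs_in_monom coeffs_in_smult is_subring_mult) auto
  moreover have "degree F \<le> n"
  proof -
    have "degree (f - monom c (Suc n)) \<le> n"
      using f(2) by (intro degree_le) (auto simp: c_def coeff_eq_0)
    then show ?thesis unfolding F_def using hdeg
      by (meson degree_add_le degree_smult_le le_trans)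
  qed
  moreover have "poly F y = A"
    using f(3) top by (simp add: F_def poly_monom algebra_simps del: power_Suc)
  ultimately show ?thesis unfolding rep_def by blast
qed

private lemma not_rep_zero: "\<not> rep y 0"
proof
  assume "rep y 0"
  then obtain f where "coeffs_in V f" "degree f = 0" "poly f y = A" unfolding rep_def by auto
  then have "A = coeff f 0" by (metis degree_eq_zeroE coeff_pCons_0 poly_pCons poly_0 mult_zero_right add_0_right)
  with \<open>coeffs_in V f\<close> A show False by (auto simp: coeffs_in_def)
qed

text \<open>Descent on \<open>n + m\<close>: the larger of the two degrees can always be lowered,
  with \<open>y\<close> and \<open>inverse y\<close> exchanging roles if necessary, yet degree 0 is
  impossible.\<close>

private lemma not_rep_both:
  "y \<noteq> 0 \<Longrightarrow> rep y n \<Longrightarrow> rep (inverse y) m \<Longrightarrow> False"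
proof (induction "n + m" arbitrary: n m rule: less_induct)
  case less
  obtain n' where n': "n = Suc n'" using less.prems not_rep_zero by (cases n) auto
  obtain m' where m': "m = Suc m'" using less.prems not_rep_zero by (cases m) auto
  show False
  proof (cases "m \<le> n")
    case True
    then have "rep y n'" using rep_step[of y n' m] less.prems n' by simp
    then show False using less.hyps[of n' m] less.prems n' by simp
  next
    case False
    then have "rep (inverse y) m'" using rep_step[of "inverse y" m' n] less.prems m' by simp
    then show False using less.hyps[of n m'] less.prems m' by simp
  qed
qed

text \<open>If \<open>y\<close> and \<open>inverse y\<close> were both outside \<open>V\<close>,
  maximality would put \<open>A\<close> into both \<open>V[y]\<close> and \<open>V[1/y]\<close>,
  which the descent excludes.\<close>

lemma maximal_avoiding_is_valuation_ring: "valuation_ring V"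
  unfolding valuation_ring_def
proof (intro conjI allI V)
  fix y show "y \<in> V \<or> inverse y \<in> V"
  proof (rule ccontr)
    assume y: "\<not> (y \<in> V \<or> inverse y \<in> V)"
    have *: "\<exists>n. rep z n" if "z \<notin> V" for z
    proof -
      have "A \<in> adjoin V z"
        using maximal[OF is_subring_adjoin[OF V] adjoin_superset[OF V]] adjoin_generator[OF V] that by metis
      then show ?thesis unfolding adjoin_def rep_def by blast
    qed
    have "y \<noteq> 0" using y is_subring_zero[OF V] by blast
    then show False using *[of y] *[of "inverse y"] y not_rep_both by blast
  qed
qed

end

text \<open>Zorn's lemma for the subrings that contain \<open>R\<close> and \<open>inverse A\<close>
  but not \<open>A\<close>. The family is nonempty because \<open>A\<close> lies in
  \<open>R[1/A]\<close> only if it is integral over \<open>R\<close>.\<close>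

lemma ex_valuation_ring_avoiding:
  fixes A :: "'a::field"
  assumes R: "is_subring R" and A: "\<not> integral_over R A"
  shows "\<exists>V. valuation_ring V \<and> R \<subseteq> V \<and> A \<notin> V"
proof -
  define F where "F = {S. is_subring S \<and> R \<subseteq> S \<and> inverse A \<in> S \<and> A \<notin> S}"
  have nz: "A \<noteq> 0"
  proof
    assume "A = 0"
    then have "integral_over R A"
      unfolding integral_over_def
      by (intro exI[of _ "monom 1 1"]) (auto simp: is_subring_closed R degree_monom_eq poly_monom)
    with A show False by simp
  qed
  have "adjoin R (inverse A) \<in> F"
    unfolding F_def using integral_over_if_in_adjoin_inverse[OF R nz] A R
    by (auto simp: is_subring_adjoin adjoin_generator adjoin_superset[THEN subsetD])
  then have "F \<noteq> {}" by blast
  moreover have "\<Union>C \<in> F" if C: "C \<noteq> {}" "subset.chain F C" for C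
  proof -
    have CF: "S \<in> F" if "S \<in> C" for S using C that by (auto simp: subset.chain_def)
    have "is_subring (\<Union>C)"
      unfolding is_subring_def
    proof (intro conjI ballI)
      show "1 \<in> \<Union>C" using C CF is_subring_one unfolding F_def by blast
      fix u v assume "u \<in> \<Union>C" "v \<in> \<Union>C"
      then obtain S where "S \<in> C" "u \<in> S" "v \<in> S"
        using C(2) unfolding subset_chain_def by blast
      then show "u - v \<in> \<Union>C" "u * v \<in> \<Union>C"
        using CF[of S] is_subring_diff is_subring_mult unfolding F_def by blast+
    qed
    then show ?thesis using C CF unfolding F_def by blast
  qed
  ultimately obtain V where V: "V \<in> F" "\<forall>S\<in>F. V \<subseteq> S \<longrightarrow> S = V"
    using subset_Zorn_nonempty[of F] by blast
  have "valuation_ring V"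
    by (rule maximal_avoiding_is_valuation_ring[of V A]) (use V in \<open>auto simp: F_def\<close>)
  then show ?thesis using V unfolding F_def by blast
qed

section \<open>Comparison of absolute values\<close>

text \<open>This is \<open>|x| \<le> |y|\<close>, expressed as divisibility over \<open>V\<close>,
  so that the value group never has to be constructed.\<close>

definition val_le :: "'a::field set \<Rightarrow> 'a \<Rightarrow> 'a \<Rightarrow> bool" where
  "val_le V x y \<longleftrightarrow> (\<exists>c\<in>V. x = c * y)"

abbreviation val_less :: "'a::field set \<Rightarrow> 'a \<Rightarrow> 'a \<Rightarrow> bool" where
  "val_less V x y \<equiv> \<not> val_le V y x"

context
  fixes V :: "'a::field set"
  assumes V: "valuation_ring V"
begin

private lemma ring: "is_subring V"
  using V by (simp add: valuation_ring_def)

lemma val_le_total: "val_le V x y \<or> val_le V y x"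
proof (cases "x = 0 \<or> y = 0")
  case True
  then show ?thesis using is_subring_zero[OF ring] by (auto simp: val_le_def)
next
  case False
  then have "x = (x / y) * y" "y = inverse (x / y) * x" by simp_all
  then show ?thesis using V unfolding val_le_def valuation_ring_def by metis
qed

lemma val_le_refl: "val_le V x x"
  using val_le_total by blast

lemma val_le_trans: "val_le V x y \<Longrightarrow> val_le V y z \<Longrightarrow> val_le V x z"
  unfolding val_le_def using is_subring_mult[OF ring] by (metis mult.assoc)

lemma val_less_le_trans: "val_less V x y \<Longrightarrow> val_le V y z \<Longrightarrow> val_less V x z"
  using val_le_trans by blast

lemma val_less_imp_le: "val_less V x y \<Longrightarrow> val_le V x y"
  using val_le_total by blast

lemma val_le_add: "val_le V x z \<Longrightarrow> val_le V y z \<Longrightarrow> val_le V (x + y) z"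
  unfolding val_le_def using is_subring_add[OF ring] by (metis distrib_right)

lemma val_le_mult: "val_le V x y \<Longrightarrow> val_le V x' y' \<Longrightarrow> val_le V (x * x') (y * y')"
  unfolding val_le_def using is_subring_mult[OF ring] by (metis mult.assoc mult.left_commute)

lemma val_le_uminus: "val_le V x y \<Longrightarrow> val_le V x (- y)"
  unfolding val_le_def using is_subring_uminus[OF ring] by (metis minus_mult_minus)

lemma val_le_zero_iff: "val_le V x 0 \<longleftrightarrow> x = 0"
  unfolding val_le_def using is_subring_zero[OF ring] by auto

lemma val_less_add: "val_less V x z \<Longrightarrow> val_less V y z \<Longrightarrow> val_less V (x + y) z"
  by (metis val_le_add val_le_refl val_le_total val_le_trans)

lemma val_less_uminus: "val_less V x z \<Longrightarrow> val_less V (- x) z"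
  using val_le_uminus[of z "- x"] by auto

lemma val_less_mult: "val_le V x y \<Longrightarrow> y \<noteq> 0 \<Longrightarrow> val_less V x' y' \<Longrightarrow> val_less V (x * x') (y * y')"
proof
  assume "val_le V x y" "y \<noteq> 0" "val_less V x' y'" "val_le V (y * y') (x * x')"
  then obtain b c where bc: "b \<in> V" "x = b * y" "c \<in> V" "y * y' = c * (x * x')"
    unfolding val_le_def by blast
  then have "y' = (c * b) * x'" using \<open>y \<noteq> 0\<close> by simp
  then have "val_le V y' x'" unfolding val_le_def using bc is_subring_mult[OF ring] by blast
  with \<open>val_less V x' y'\<close> show False by simp
qed

text \<open>All terms of the expanded determinant other than \<open>xb * yc\<close> have smaller absolute value.\<close>

lemma rainbow_determinant:
  assumes a: "val_less V xa 1" "val_less V ya 1"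
    and b: "val_le V 1 xb" "val_le V yb xb"
    and c: "val_le V 1 yc" "val_less V xc yc"
  shows "val_le V 1 ((xb - xa) * (yc - ya) - (yb - ya) * (xc - xa))"
proof (rule ccontr)
  let ?D = "(xb - xa) * (yc - ya) - (yb - ya) * (xc - xa)"
  assume D: "val_less V ?D 1"
  let ?M = "xb * yc"
  have nz: "xb \<noteq> 0" "yc \<noteq> 0" using b c val_le_zero_iff[of 1] by auto
  have less_M: "val_less V (x * y) ?M" if "val_le V x xb" "val_less V y yc" for x y
    using val_less_mult that nz by blast
  have ay: "val_less V xa yc" "val_less V ya yc" and ax: "val_le V ya xb" "val_less V xa xb"
    using a b c val_less_le_trans val_less_imp_le by blast+
  have "val_less V (yc * xa) (yc * xb)"
    by (intro val_less_mult val_le_refl nz ax)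
  then have "val_less V (xa * yc) ?M" by (simp add: mult.commute)
  moreover have "val_less V (xb * ya) ?M" "val_less V (yb * xc) ?M" "val_less V (yb * xa) ?M"
      "val_less V (ya * xc) ?M"
    using less_M val_le_refl b c ay ax by blast+
  moreover have "val_less V ?D ?M"
  proof -
    have "val_le V 1 ?M"
      using val_le_mult[of 1 xb 1 yc] b c by simp
    then show ?thesis using D val_le_trans by blast
  qed
  \<comment> \<open>Since \<open>1 \<le> |?M|\<close>, the assumption on \<open>?D\<close> makes it
    smaller than \<open>?M\<close> too. The sum formed here is \<open>?M\<close> itself, which would
    thus be smaller than itself.\<close>
  ultimately have "val_less V (?D + xb * ya + xa * yc + yb * xc + - (yb * xa) + - (ya * xc)) ?M"
    by (intro val_less_add val_less_uminus)
  moreover have "?D + xb * ya + xa * yc + yb * xc + - (yb * xa) + - (ya * xc) = ?M"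
    by (simp add: algebra_simps)
  ultimately show False using val_le_refl by metis
qed

end

section \<open>Triangles in the plane\<close>

text \<open>Twice the signed area, positive for counterclockwise triangles.\<close>

definition area2 :: "real^2 \<Rightarrow> real^2 \<Rightarrow> real^2 \<Rightarrow> real" where
  "area2 u v w = (v$1 - u$1) * (w$2 - u$2) - (v$2 - u$2) * (w$1 - u$1)"

lemma area2_rotate: "area2 v w u = area2 u v w"
  by (simp add: area2_def algebra_simps)

lemma area2_swap: "area2 v u w = - area2 u v w"
  by (simp add: area2_def algebra_simps)

lemma area2_degenerate [simp]: "area2 u u w = 0" "area2 u w u = 0" "area2 u w w = 0"
  by (simp_all add: area2_def algebra_simps)

lemma area2_translate:
  "area2 u v (x + t *\<^sub>R y) = area2 u v x + t * ((v$1 - u$1) * y$2 - (v$2 - u$2) * y$1)"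
  by (simp add: area2_def algebra_simps)

lemma convex_area2: "convex {z. area2 u v z \<ge> 0}"
proof (rule convexI)
  fix x y and a b :: real
  assume h: "x \<in> {z. area2 u v z \<ge> 0}" "y \<in> {z. area2 u v z \<ge> 0}" "0 \<le> a" "0 \<le> b" "a + b = 1"
  then have b: "b = 1 - a" by simp
  have "area2 u v (a *\<^sub>R x + b *\<^sub>R y) = a * area2 u v x + b * area2 u v y"
    by (simp add: area2_def b algebra_simps)
  then show "a *\<^sub>R x + b *\<^sub>R y \<in> {z. area2 u v z \<ge> 0}" using h by simp
qed

lemma area2_eq_zero_iff_collinear: "area2 u v w = 0 \<longleftrightarrow> collinear {u, v, w}"
proof
  assume "collinear {u, v, w}"
  then obtain a d where "\<forall>x\<in>{u, v, w}. \<exists>c. x = a + c *\<^sub>R d" unfolding collinear_alt by blast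
  then obtain \<alpha> \<beta> \<gamma> where "u = a + \<alpha> *\<^sub>R d" "v = a + \<beta> *\<^sub>R d" "w = a + \<gamma> *\<^sub>R d" by auto
  then show "area2 u v w = 0" by (simp add: area2_def algebra_simps)
next
  assume z: "area2 u v w = 0"
  show "collinear {u, v, w}"
  proof (cases "u = v")
    case True then show ?thesis by simp
  next
    case False
    define d where "d = v - u"
    define c where "c = ((w - u) \<bullet> d) / (d \<bullet> d)"
    have dd: "d \<bullet> d \<noteq> 0" using False by (simp add: d_def)
    have z': "d$1 * (w$2 - u$2) = d$2 * (w$1 - u$1)"
      using z by (simp add: area2_def d_def)
    \<comment> \<open>For parallel vectors \<open>d = (a, b)\<close> and
      \<open>w - u = (x, y)\<close>, projecting \<open>w - u\<close> onto \<open>d\<close> changes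
      nothing; this is that fact multiplied by \<open>d \<bullet> d\<close>.\<close>
    have aux: "(a * a + b * b) * x = (x * a + y * b) * a" "(a * a + b * b) * y = (x * a + y * b) * b"
      if "a * y = b * x" for a b x y :: real
      using that by algebra+
    have "(d \<bullet> d) * (w$i - u$i) = ((w - u) \<bullet> d) * d$i" for i
      using exhaust_2[of i] aux[OF z'] by (auto simp: inner_vec_def sum_2)
    then have "w = u + c *\<^sub>R d"
      using dd by (simp add: vec_eq_iff c_def field_simps)
    moreover have "u = u + 0 *\<^sub>R d" "v = u + 1 *\<^sub>R d" by (simp_all add: d_def)
    ultimately show ?thesis unfolding collinear_alt by blast
  qed
qed

lemma measure_triangle: "measure lebesgue (convex hull {u, v, w}) = \<bar>area2 u v w\<bar> / 2"
proof -
  have "closed (convex hull {u, v, w})"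
    by (simp add: finite_imp_compact_convex_hull compact_imp_closed)
  then have "measure lebesgue (convex hull {u, v, w}) = measure lborel (convex hull {u, v, w})"
    by (simp add: measure_completion)
  also have "\<dots> = \<bar>(w$1 - u$1) * (v$2 - u$2) - (v$1 - u$1) * (w$2 - u$2)\<bar> / 2"
    by (rule content_triangle)
  also have "\<dots> = \<bar>area2 u v w\<bar> / 2"
    unfolding area2_def by (subst abs_minus_commute) (simp add: mult.commute)
  finally show ?thesis .
qed

text \<open>The three areas on the right, divided by \<open>area2 u v w\<close>, are the barycentric
  coordinates of \<open>z\<close>.\<close>

lemma mem_triangle_iff:
  assumes D: "area2 u v w > 0"
  shows "z \<in> convex hull {u, v, w} \<longleftrightarrow> area2 u v z \<ge> 0 \<and> area2 v w z \<ge> 0 \<and> area2 w u z \<ge> 0"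
proof
  assume z: "z \<in> convex hull {u, v, w}"
  have *: "area2 a b z \<ge> 0" if "area2 a b u \<ge> 0" "area2 a b v \<ge> 0" "area2 a b w \<ge> 0" for a b
    using hull_minimal[of "{u, v, w}" "{z. area2 a b z \<ge> 0}" convex] convex_area2[of a b] z that by auto
  show "area2 u v z \<ge> 0 \<and> area2 v w z \<ge> 0 \<and> area2 w u z \<ge> 0"
    using D area2_rotate[of u v w] area2_rotate[of v w u] by (intro conjI *) auto
next
  assume z: "area2 u v z \<ge> 0 \<and> area2 v w z \<ge> 0 \<and> area2 w u z \<ge> 0"
  let ?D = "area2 u v w"
  have bary: "?D * z$i = area2 v w z * u$i + area2 w u z * v$i + area2 u v z * w$i" for i
    using exhaust_2[of i] by (auto simp: area2_def algebra_simps)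
  have "z = (area2 v w z / ?D) *\<^sub>R u + (area2 w u z / ?D) *\<^sub>R v + (area2 u v z / ?D) *\<^sub>R w"
    using D bary by (simp add: vec_eq_iff field_simps)
  moreover have "area2 v w z + area2 w u z + area2 u v z = ?D"
    by (simp add: area2_def algebra_simps)
  then have "area2 v w z / ?D + area2 w u z / ?D + area2 u v z / ?D = 1"
    using D by (simp flip: add_divide_distrib)
  moreover have "area2 v w z / ?D \<ge> 0" "area2 w u z / ?D \<ge> 0" "area2 u v z / ?D \<ge> 0"
    using z D by auto
  ultimately show "z \<in> convex hull {u, v, w}"
    unfolding convex_hull_3 by blast
qed

definition in_open_triangle :: "real^2 \<Rightarrow> real^2 \<Rightarrow> real^2 \<Rightarrow> real^2 \<Rightarrow> bool" where
  "in_open_triangle u v w z \<longleftrightarrow> area2 u v z > 0 \<and> area2 v w z > 0 \<and> area2 w u z > 0"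

lemma in_open_triangle_rotate: "in_open_triangle v w u = in_open_triangle u v w"
  by (auto simp: in_open_triangle_def fun_eq_iff)

lemma in_open_triangle_imp_interior:
  assumes "area2 u v w > 0" "in_open_triangle u v w z"
  shows "z \<in> interior (convex hull {u, v, w})"
proof (rule interiorI)
  show "open {z. in_open_triangle u v w z}"
    unfolding in_open_triangle_def area2_def by (intro open_Collect_conj open_Collect_less continuous_intros)
  show "{z. in_open_triangle u v w z} \<subseteq> convex hull {u, v, w}"
    unfolding subset_iff mem_triangle_iff[OF assms(1)] by (simp add: in_open_triangle_def)
qed (use assms in simp)

section \<open>Telescoping of signed segments on the real line\<close>

lemma eventually_compare_at_right:
  fixes x a :: real
  shows "\<forall>\<^sub>F \<epsilon> in at_right 0. \<epsilon> > 0 \<and> (x - \<epsilon> < a \<longleftrightarrow> x \<le> a) \<and> (a < x - \<epsilon> \<longleftrightarrow> a < x) \<and>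
    (x + \<epsilon> < a \<longleftrightarrow> x < a) \<and> (a < x + \<epsilon> \<longleftrightarrow> a \<le> x)"
  unfolding eventually_at_right_field
  by (rule exI[of _ "if a = x then 1 else \<bar>x - a\<bar>"]) auto

text \<open>The indicator of an oriented interval. Its distributional derivative is the point mass
  at \<open>\<alpha>\<close> minus the point mass at \<open>\<beta>\<close>.\<close>

definition signed_seg :: "real \<Rightarrow> real \<Rightarrow> real \<Rightarrow> real" where
  "signed_seg \<alpha> \<beta> t = (if \<alpha> < t \<and> t < \<beta> then 1 else if \<beta> < t \<and> t < \<alpha> then -1 else 0)"

text \<open>A combination that vanishes off a finite set has no jump at any \<open>x\<close>. Its
  jump there is the weighted number of end points minus the weighted number of starting points equal
  to \<open>x\<close>; these identities are then summed with weights \<open>g x\<close>.\<close>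

lemma signed_segments_telescope:
  fixes c \<alpha> \<beta> :: "'e \<Rightarrow> real" and g :: "real \<Rightarrow> real"
  assumes E: "finite E" and B: "finite B"
    and zero: "\<And>t. t \<notin> B \<Longrightarrow> (\<Sum>e\<in>E. c e * signed_seg (\<alpha> e) (\<beta> e) t) = 0"
  shows "(\<Sum>e\<in>E. c e * (g (\<beta> e) - g (\<alpha> e))) = 0"
proof -
  have jump: "(\<Sum>e\<in>E. c e * (of_bool (\<beta> e = x) - of_bool (\<alpha> e = x))) = 0" for x
  proof -
    have "\<forall>\<^sub>F \<epsilon> in at_right 0. signed_seg a b (x - \<epsilon>) - signed_seg a b (x + \<epsilon>) =
        of_bool (b = x) - of_bool (a = x)" for a b
      using eventually_compare_at_right[of x a] eventually_compare_at_right[of x b]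
      by eventually_elim (auto simp: signed_seg_def)
    then have "\<forall>\<^sub>F \<epsilon> in at_right 0. \<forall>e\<in>E. signed_seg (\<alpha> e) (\<beta> e) (x - \<epsilon>) -
        signed_seg (\<alpha> e) (\<beta> e) (x + \<epsilon>) = of_bool (\<beta> e = x) - of_bool (\<alpha> e = x)"
      using E by (simp add: eventually_ball_finite)
    moreover have "\<forall>\<^sub>F \<epsilon> in at_right 0. x - \<epsilon> \<noteq> b \<and> x + \<epsilon> \<noteq> b" for b
      using eventually_compare_at_right[of x b] by eventually_elim auto
    then have "\<forall>\<^sub>F \<epsilon> in at_right 0. \<forall>b\<in>B. x - \<epsilon> \<noteq> b \<and> x + \<epsilon> \<noteq> b"
      using B by (simp add: eventually_ball_finite)
    ultimately have "\<forall>\<^sub>F \<epsilon> in at_right (0::real). (\<Sum>e\<in>E. c e * (of_bool (\<beta> e = x) - of_bool (\<alpha> e = x))) = 0"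
    proof eventually_elim
      case (elim \<epsilon>)
      have "(\<Sum>e\<in>E. c e * (of_bool (\<beta> e = x) - of_bool (\<alpha> e = x))) =
          (\<Sum>e\<in>E. c e * (signed_seg (\<alpha> e) (\<beta> e) (x - \<epsilon>) - signed_seg (\<alpha> e) (\<beta> e) (x + \<epsilon>)))"
        using elim(1) by (intro sum.cong) auto
      also have "\<dots> = 0"
      proof -
        have "x - \<epsilon> \<notin> B" "x + \<epsilon> \<notin> B" using elim(2) by blast+
        then show ?thesis by (simp add: right_diff_distrib sum_subtractf zero)
      qed
      finally show ?case .
    qed
    then show ?thesis by simp
  qed
  define X where "X = \<alpha> ` E \<union> \<beta> ` E"
  have X: "finite X" using E by (simp add: X_def)
  have ev: "g y = (\<Sum>x\<in>X. g x * of_bool (y = x))" if "y \<in> X" for y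
    using X that by (simp add: of_bool_def sum.delta if_distrib cong: if_cong)
  have "(\<Sum>e\<in>E. c e * (g (\<beta> e) - g (\<alpha> e))) =
      (\<Sum>e\<in>E. \<Sum>x\<in>X. g x * (c e * (of_bool (\<beta> e = x) - of_bool (\<alpha> e = x))))"
  proof (rule sum.cong[OF refl])
    fix e assume "e \<in> E"
    then have "\<alpha> e \<in> X" "\<beta> e \<in> X" by (auto simp: X_def)
    then have "c e * (g (\<beta> e) - g (\<alpha> e)) =
        c e * ((\<Sum>x\<in>X. g x * of_bool (\<beta> e = x)) - (\<Sum>x\<in>X. g x * of_bool (\<alpha> e = x)))"
      using ev by metis
    then show "c e * (g (\<beta> e) - g (\<alpha> e)) =
        (\<Sum>x\<in>X. g x * (c e * (of_bool (\<beta> e = x) - of_bool (\<alpha> e = x))))"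
      by (simp add: right_diff_distrib sum_subtractf sum_distrib_left mult.left_commute)
  qed
  also have "\<dots> = (\<Sum>x\<in>X. g x * (\<Sum>e\<in>E. c e * (of_bool (\<beta> e = x) - of_bool (\<alpha> e = x))))"
    by (subst sum.swap) (simp add: sum_distrib_left)
  also have "\<dots> = 0" by (simp add: jump)
  finally show ?thesis .
qed


section \<open>Lines, their parameters and their crossings\<close>

definition line :: "real^2 \<Rightarrow> real^2 \<Rightarrow> (real^2) set" where
  "line P d = range (\<lambda>t. P + t *\<^sub>R d)"

text \<open>The parameter of the orthogonal projection to the line, which makes it defined off the
  line as well.\<close>

definition param :: "real^2 \<Rightarrow> real^2 \<Rightarrow> real^2 \<Rightarrow> real" where
  "param P d z = ((z - P) \<bullet> d) / (d \<bullet> d)"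

lemma param_line: "d \<noteq> 0 \<Longrightarrow> param P d (P + t *\<^sub>R d) = t"
  by (simp add: param_def)

lemma mem_line_iff: "d \<noteq> 0 \<Longrightarrow> z \<in> line P d \<longleftrightarrow> z = P + param P d z *\<^sub>R d"
  by (auto simp: line_def param_line)

lemma line_eqI:
  assumes "a \<noteq> b" "a \<in> line P d" "b \<in> line P d"
  shows "line a (b - a) = line P d"
proof -
  obtain \<alpha> \<beta> where ab: "a = P + \<alpha> *\<^sub>R d" "b = P + \<beta> *\<^sub>R d" using assms by (auto simp: line_def)
  then have ne: "\<alpha> \<noteq> \<beta>" using assms by auto
  have 1: "a + t *\<^sub>R (b - a) = P + (\<alpha> + t * (\<beta> - \<alpha>)) *\<^sub>R d" for t
    by (simp add: ab algebra_simps)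
  have 2: "P + t *\<^sub>R d = a + ((t - \<alpha>) / (\<beta> - \<alpha>)) *\<^sub>R (b - a)" for t
    unfolding 1 using ne by simp
  show ?thesis
    unfolding line_def by (auto simp: image_iff) (metis 1, metis 2)
qed

text \<open>This allows edges to be grouped by the line that carries them.\<close>

lemma line_eq_iff:
  assumes "a \<noteq> b"
  shows "line a (b - a) = line P d \<longleftrightarrow> a \<in> line P d \<and> b \<in> line P d"
proof
  assume "line a (b - a) = line P d"
  moreover have "a = a + 0 *\<^sub>R (b - a)" "b = a + 1 *\<^sub>R (b - a)" by simp_all
  ultimately show "a \<in> line P d \<and> b \<in> line P d" unfolding line_def by (metis rangeI)
qed (use assms line_eqI in blast)

lemma area2_line:
  "area2 (P + \<alpha> *\<^sub>R d) (P + \<beta> *\<^sub>R d) w = (\<beta> - \<alpha>) * area2 P (P + d) w"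
  by (simp add: area2_def algebra_simps)

lemma area2_eq_zero_on_line: "u \<in> line P d \<Longrightarrow> v \<in> line P d \<Longrightarrow> w \<in> line P d \<Longrightarrow> area2 u v w = 0"
  by (auto simp: line_def area2_def algebra_simps)

lemma area2_eq_zero_imp_mem_line: "u \<noteq> v \<Longrightarrow> area2 u v w = 0 \<Longrightarrow> w \<in> line u (v - u)"
  unfolding area2_eq_zero_iff_collinear collinear_3_affine_hull affine_hull_2_alt line_def .

text \<open>Two different zeros would give two common points of the lines and make them equal, so
  there is at most one.\<close>

lemma finite_crossings:
  assumes ab: "a \<noteq> b" and d: "d \<noteq> 0" and L: "line a (b - a) \<noteq> line P d"
  shows "finite {t. area2 a b (P + t *\<^sub>R d) = 0}"
proof -
  have "s = t" if "area2 a b (P + s *\<^sub>R d) = 0" "area2 a b (P + t *\<^sub>R d) = 0" for s t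
  proof (rule ccontr)
    assume "s \<noteq> t"
    then have ne: "P + s *\<^sub>R d \<noteq> P + t *\<^sub>R d" using d by simp
    have "line (P + s *\<^sub>R d) ((P + t *\<^sub>R d) - (P + s *\<^sub>R d)) = line a (b - a)"
      using that ab by (intro line_eqI[OF ne] area2_eq_zero_imp_mem_line)
    moreover have "line (P + s *\<^sub>R d) ((P + t *\<^sub>R d) - (P + s *\<^sub>R d)) = line P d"
      by (intro line_eqI[OF ne]) (auto simp: line_def)
    ultimately show False using L by simp
  qed
  then have "{t. area2 a b (P + t *\<^sub>R d) = 0} \<subseteq> {t}" if "area2 a b (P + t *\<^sub>R d) = 0" for t
    using that by blast
  then show ?thesis by (metis (mono_tags, lifting) Collect_empty_eq finite.emptyI finite.insertI finite_subset)
qed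

section \<open>Jumps of a triangle's indicator across a line\<close>

text \<open>The counterclockwise quarter turn of \<open>d\<close>, pointing to the left of the
  direction \<open>d\<close>.\<close>

definition normal :: "real^2 \<Rightarrow> real^2" where
  "normal d = vector [- d$2, d$1]"

lemma normal_uminus: "normal (- d) = - normal d"
  by (simp add: normal_def vec_eq_iff forall_2)

lemma eventually_area2_sign:
  assumes "area2 u v x \<noteq> 0"
  shows "\<forall>\<^sub>F \<epsilon> in at_right 0. area2 u v (x + \<epsilon> *\<^sub>R y) \<noteq> 0 \<and>
    (area2 u v (x + \<epsilon> *\<^sub>R y) > 0 \<longleftrightarrow> area2 u v x > 0)"
proof -
  let ?c = "(v$1 - u$1) * y$2 - (v$2 - u$2) * y$1"
  have lim: "((\<lambda>\<epsilon>. area2 u v x + \<epsilon> * ?c) \<longlongrightarrow> area2 u v x) (at_right 0)"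
    by (auto intro!: tendsto_eq_intros)
  show ?thesis
  proof (cases "area2 u v x > 0")
    case True
    show ?thesis
      using order_tendstoD(1)[OF lim True] by eventually_elim (use True in \<open>simp add: area2_translate\<close>)
  next
    case False
    then have neg: "area2 u v x < 0" using assms by simp
    show ?thesis
      using order_tendstoD(2)[OF lim neg] by eventually_elim (use neg in \<open>simp add: area2_translate\<close>)
  qed
qed

lemma area2_normal:
  "area2 (P + \<alpha> *\<^sub>R d) (P + \<beta> *\<^sub>R d) (P + t *\<^sub>R d + \<epsilon> *\<^sub>R normal d) = \<epsilon> * ((\<beta> - \<alpha>) * (d \<bullet> d))"
  by (simp add: area2_def normal_def inner_vec_def sum_2 algebra_simps)

text \<open>The indicator of the open triangle just to the left of \<open>x\<close>, seen in
  direction \<open>d\<close>, minus its value just to the right.\<close>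

abbreviation side_jump :: "real^2 \<Rightarrow> real^2 \<Rightarrow> real^2 \<Rightarrow> real^2 \<Rightarrow> real^2 \<Rightarrow> real \<Rightarrow> real" where
  "side_jump u v w d x \<epsilon> \<equiv>
    of_bool (in_open_triangle u v w (x + \<epsilon> *\<^sub>R normal d)) - of_bool (in_open_triangle u v w (x + \<epsilon> *\<^sub>R normal (- d)))"

text \<open>The triangle lies to the left of its edge \<open>uv\<close>, which is the left of
  \<open>d\<close> if \<open>\<alpha> < \<beta>\<close> and the right if
  \<open>\<beta> < \<alpha>\<close>. The other two edges decide whether \<open>t\<close> is between
  \<open>\<alpha>\<close> and \<open>\<beta>\<close>.\<close>

lemma side_jump_along_edge:
  assumes D: "area2 u v w > 0" and d: "d \<noteq> 0"
    and u: "u = P + \<alpha> *\<^sub>R d" and v: "v = P + \<beta> *\<^sub>R d" and x: "x = P + t *\<^sub>R d"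
    and nz: "area2 v w x \<noteq> 0" "area2 w u x \<noteq> 0"
  shows "\<forall>\<^sub>F \<epsilon> in at_right 0. side_jump u v w d x \<epsilon> = signed_seg \<alpha> \<beta> t"
proof -
  \<comment> \<open>Since \<open>(\<beta> - \<alpha>) * k\<close> is \<open>area2 u v w\<close>, the
    sign of \<open>k\<close> is that of \<open>\<beta> - \<alpha>\<close>.\<close>
  define k where "k = area2 P (P + d) w"
  have 1: "(\<beta> - \<alpha>) * k > 0" using D unfolding u v area2_line k_def .
  have 2: "area2 v w x = (\<beta> - t) * k"
    using area2_line[of P t d \<beta> w] area2_rotate[of v w x] area2_rotate[of w x v] by (simp add: x v k_def)
  have 3: "area2 w u x = (t - \<alpha>) * k"
    using area2_line[of P \<alpha> d t w] area2_rotate[of u x w] area2_rotate[of x w u]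
    by (simp add: x u k_def)
  have plus: "area2 u v (x + \<epsilon> *\<^sub>R normal d) = \<epsilon> * ((\<beta> - \<alpha>) * (d \<bullet> d))" for \<epsilon>
    unfolding u v x by (rule area2_normal)
  have minus: "area2 u v (x + \<epsilon> *\<^sub>R normal (- d)) = \<epsilon> * ((\<alpha> - \<beta>) * (d \<bullet> d))" for \<epsilon>
    using plus[of "- \<epsilon>"] by (simp add: normal_uminus algebra_simps)
  have dd: "y * (d \<bullet> d) > 0 \<longleftrightarrow> y > 0" for y
  proof -
    have "d \<bullet> d > 0" using d by simp
    then show ?thesis by (metis mult_pos_pos zero_less_mult_pos2)
  qed
  have pos: "area2 u v (x + \<epsilon> *\<^sub>R normal d) > 0 \<longleftrightarrow> \<alpha> < \<beta>"
      "area2 u v (x + \<epsilon> *\<^sub>R normal (- d)) > 0 \<longleftrightarrow> \<beta> < \<alpha>" if "\<epsilon> > 0" for \<epsilon>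
    using that dd[of "\<beta> - \<alpha>"] dd[of "\<alpha> - \<beta>"] unfolding plus minus
    by (metis diff_gt_0_iff_gt zero_less_mult_pos mult_pos_pos)+
  note ev = eventually_area2_sign[OF nz(1), of "normal d"] eventually_area2_sign[OF nz(2), of "normal d"]
    eventually_area2_sign[OF nz(1), of "normal (- d)"] eventually_area2_sign[OF nz(2), of "normal (- d)"]
    eventually_at_right_less[of "0::real"]
  from ev show ?thesis
  proof eventually_elim
    case (elim \<epsilon>)
    have "in_open_triangle u v w (x + \<epsilon> *\<^sub>R normal d) \<longleftrightarrow> \<alpha> < \<beta> \<and> (\<beta> - t) * k > 0 \<and> (t - \<alpha>) * k > 0"
      using elim pos[of \<epsilon>] by (simp only: in_open_triangle_def 2 3 simp_thms)
    moreover have "in_open_triangle u v w (x + \<epsilon> *\<^sub>R normal (- d)) \<longleftrightarrow>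
        \<beta> < \<alpha> \<and> (\<beta> - t) * k > 0 \<and> (t - \<alpha>) * k > 0"
      using elim pos[of \<epsilon>] by (simp only: in_open_triangle_def 2 3 simp_thms)
    ultimately show ?case
      using 1 by (auto simp: signed_seg_def zero_less_mult_iff)
  qed
qed

definition on_line :: "real^2 \<Rightarrow> real^2 \<Rightarrow> real^2 \<Rightarrow> real^2 \<Rightarrow> bool" where
  "on_line P d a b \<longleftrightarrow> a \<in> line P d \<and> b \<in> line P d"

definition edge_trace :: "real^2 \<Rightarrow> real^2 \<Rightarrow> real^2 \<Rightarrow> real^2 \<Rightarrow> real \<Rightarrow> real" where
  "edge_trace P d a b t = (if on_line P d a b then signed_seg (param P d a) (param P d b) t else 0)"

text \<open>A nondegenerate triangle has at most one edge on the line, and a rotation makes it the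
  first. If there is none, \<open>x\<close> is off all three edge lines and the indicator is
  constant near \<open>x\<close>.\<close>

lemma side_jump_eq_edge_traces:
  assumes D: "area2 u v w > 0" and d: "d \<noteq> 0" and x: "x = P + t *\<^sub>R d"
    and uv: "on_line P d u v \<or> area2 u v x \<noteq> 0"
    and vw: "on_line P d v w \<or> area2 v w x \<noteq> 0"
    and wu: "on_line P d w u \<or> area2 w u x \<noteq> 0"
  shows "\<forall>\<^sub>F \<epsilon> in at_right 0. side_jump u v w d x \<epsilon> =
    edge_trace P d u v t + edge_trace P d v w t + edge_trace P d w u t"
proof -
  have edge: "\<forall>\<^sub>F \<epsilon> in at_right 0. side_jump a b c d x \<epsilon> =
      edge_trace P d a b t + edge_trace P d b c t + edge_trace P d c a t"
    if D: "area2 a b c > 0" and ab: "on_line P d a b"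
      and bc: "on_line P d b c \<or> area2 b c x \<noteq> 0" and ca: "on_line P d c a \<or> area2 c a x \<noteq> 0" for a b c
  proof -
    have "c \<notin> line P d" using area2_eq_zero_on_line[of a P d b c] D ab by (auto simp: on_line_def)
    then have not: "\<not> on_line P d b c" "\<not> on_line P d c a" by (auto simp: on_line_def)
    have "a = P + param P d a *\<^sub>R d" "b = P + param P d b *\<^sub>R d"
      using ab d by (auto simp: on_line_def mem_line_iff)
    from side_jump_along_edge[OF D d this x] not bc ca ab
    show ?thesis by (simp add: edge_trace_def)
  qed
  consider "on_line P d u v" | "on_line P d v w" | "on_line P d w u"
    | "\<not> on_line P d u v" "\<not> on_line P d v w" "\<not> on_line P d w u" by blast
  then show ?thesis
  proof cases
    case 1 then show ?thesis using edge[OF D 1 vw wu] by simp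
  next
    case 2
    have "area2 v w u > 0" using D area2_rotate[of v w u] by simp
    from edge[OF this 2 wu uv] show ?thesis
      unfolding in_open_triangle_rotate[of v w u] by eventually_elim linarith
  next
    case 3
    have "area2 w u v > 0" using D area2_rotate[of u v w] by simp
    from edge[OF this 3 uv vw] show ?thesis
      unfolding in_open_triangle_rotate[of u v w, symmetric] by eventually_elim linarith
  next
    case 4
    then have nz: "area2 u v x \<noteq> 0" "area2 v w x \<noteq> 0" "area2 w u x \<noteq> 0" using uv vw wu by auto
    from nz[THEN eventually_area2_sign, of "normal d"] nz[THEN eventually_area2_sign, of "normal (- d)"]
    show ?thesis
      by eventually_elim (use 4 in \<open>auto simp: in_open_triangle_def edge_trace_def\<close>)
  qed
qed

text \<open>Avoids the whole lines through the edges; at such points closed and open triangle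
  agree.\<close>

definition off_edges :: "real^2 \<Rightarrow> real^2 \<Rightarrow> real^2 \<Rightarrow> real^2 \<Rightarrow> bool" where
  "off_edges u v w z \<longleftrightarrow> area2 u v z \<noteq> 0 \<and> area2 v w z \<noteq> 0 \<and> area2 w u z \<noteq> 0"

text \<open>Either \<open>x\<close> is off the line \<open>ab\<close> and continuity suffices, or
  that line is \<open>line P d\<close> and any step along the normal leaves it.\<close>

lemma eventually_off_line:
  assumes d: "d \<noteq> 0" and x: "x = P + t *\<^sub>R d" and ab: "a \<noteq> b"
    and gen: "on_line P d a b \<or> area2 a b x \<noteq> 0"
  shows "\<forall>\<^sub>F \<epsilon> in at_right 0. area2 a b (x + \<epsilon> *\<^sub>R normal d) \<noteq> 0 \<and>
    area2 a b (x + \<epsilon> *\<^sub>R normal (- d)) \<noteq> 0"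
proof (cases "area2 a b x = 0")
  case False
  show ?thesis
    using eventually_area2_sign[OF False, of "normal d"] eventually_area2_sign[OF False, of "normal (- d)"]
    by eventually_elim blast
next
  case True
  then obtain \<alpha> \<beta> where ab': "a = P + \<alpha> *\<^sub>R d" "b = P + \<beta> *\<^sub>R d"
    using gen by (auto simp: on_line_def line_def)
  then have ne: "\<beta> - \<alpha> \<noteq> 0" using ab by auto
  have dd: "d \<bullet> d \<noteq> 0" using d by simp
  have *: "area2 a b (x + \<epsilon> *\<^sub>R normal d) = \<epsilon> * ((\<beta> - \<alpha>) * (d \<bullet> d))" for \<epsilon>
    unfolding ab' x by (rule area2_normal)
  have **: "area2 a b (x + \<epsilon> *\<^sub>R normal (- d)) = (- \<epsilon>) * ((\<beta> - \<alpha>) * (d \<bullet> d))" for \<epsilon>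
    unfolding *[of "- \<epsilon>", symmetric] by (simp add: normal_uminus)
  show ?thesis
    using eventually_at_right_less[of "0::real"]
    by eventually_elim (use ne dd in \<open>simp only: * ** mult_eq_0_iff neg_equal_0_iff_equal, simp\<close>)
qed

section \<open>Cancellation of the directed edges of weighted triangles\<close>

text \<open>The edges are grouped by their lines. Across each line the weighted count of triangles
  is 0 on both sides, so its jump, a combination of signed segments, vanishes for all but finitely
  many parameters and the telescoping applies.\<close>

lemma boundary_sum_eq_zero:
  fixes U V W :: "'i \<Rightarrow> real^2" and c :: "'i \<Rightarrow> real" and \<phi> :: "real^2 \<Rightarrow> real^2 \<Rightarrow> real"
  assumes K: "finite K" and D: "\<And>i. i \<in> K \<Longrightarrow> area2 (U i) (V i) (W i) > 0"
    and additive: "\<And>u v w. area2 u v w = 0 \<Longrightarrow> \<phi> u w = \<phi> u v + \<phi> v w"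
    and zero: "\<And>z. (\<And>i. i \<in> K \<Longrightarrow> off_edges (U i) (V i) (W i) z) \<Longrightarrow>
      (\<Sum>i\<in>K. c i * of_bool (in_open_triangle (U i) (V i) (W i) z)) = 0"
  shows "(\<Sum>i\<in>K. c i * (\<phi> (U i) (V i) + \<phi> (V i) (W i) + \<phi> (W i) (U i))) = 0"
proof -
  \<comment> \<open>Position 0, 1, 2 stands for the edge from \<open>U\<close> to \<open>V\<close>,
    from \<open>V\<close> to \<open>W\<close>, from \<open>W\<close> to \<open>U\<close>.\<close>
  define E where "E = K \<times> {0, 1, 2::nat}"
  define src where "src e = (if snd e = 0 then U else if snd e = 1 then V else W) (fst e)" for e :: "'i \<times> nat"
  define tgt where "tgt e = (if snd e = 0 then V else if snd e = 1 then W else U) (fst e)" for e :: "'i \<times> nat"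
  define C where "C e = c (fst e)" for e :: "'i \<times> nat"
  have finE: "finite E" using K by (simp add: E_def)
  have sumE: "(\<Sum>e\<in>E. C e * F (src e) (tgt e)) =
      (\<Sum>i\<in>K. c i * (F (U i) (V i) + F (V i) (W i) + F (W i) (U i)))" for F
  proof -
    have "(\<Sum>e\<in>E. C e * F (src e) (tgt e)) =
        (\<Sum>i\<in>K. \<Sum>j\<in>{0, 1, 2::nat}. C (i, j) * F (src (i, j)) (tgt (i, j)))"
      unfolding E_def sum.cartesian_product by (rule sum.cong) auto
    also have "\<dots> = (\<Sum>i\<in>K. c i * (F (U i) (V i) + F (V i) (W i) + F (W i) (U i)))"
      by (intro sum.cong refl) (simp add: C_def src_def tgt_def algebra_simps)
    finally show ?thesis .
  qed
  have ne: "U i \<noteq> V i" "V i \<noteq> W i" "W i \<noteq> U i" if "i \<in> K" for i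
    using D[OF that] by auto
  have neE: "src e \<noteq> tgt e" if "e \<in> E" for e
    using ne[of "fst e"] that by (auto simp: E_def src_def tgt_def)
  have edge: "src (i, 0) = U i" "src (i, 1) = V i" "src (i, 2) = W i"
    "tgt (i, 0) = V i" "tgt (i, 1) = W i" "tgt (i, 2) = U i" for i
    by (simp_all add: src_def tgt_def)
  have on_one_line: "(\<Sum>e\<in>{e \<in> E. on_line P d (src e) (tgt e)}. C e * \<phi> (src e) (tgt e)) = 0"
    if d: "d \<noteq> 0" for P d
  proof -
    define E' where "E' = {e \<in> E. on_line P d (src e) (tgt e)}"
    \<comment> \<open>The exceptional parameters, where the line is crossed by the line of an edge
      that it does not carry.\<close>
    define B where "B = (\<Union>e \<in> E - E'. {t. area2 (src e) (tgt e) (P + t *\<^sub>R d) = 0})"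
    have "finite {t. area2 (src e) (tgt e) (P + t *\<^sub>R d) = 0}" if e: "e \<in> E - E'" for e
    proof (rule finite_crossings[OF _ d])
      show ne: "src e \<noteq> tgt e" using e neE by blast
      show "line (src e) (tgt e - src e) \<noteq> line P d"
        unfolding line_eq_iff[OF ne] using e by (simp add: E'_def on_line_def)
    qed
    then have finB: "finite B" using finE by (simp add: B_def)
    have trace: "(\<Sum>e\<in>E'. C e * signed_seg (param P d (src e)) (param P d (tgt e)) t) = 0"
      if t: "t \<notin> B" for t
    proof -
      define x where "x = P + t *\<^sub>R d"
      have gen: "on_line P d (src e) (tgt e) \<or> area2 (src e) (tgt e) x \<noteq> 0" if "e \<in> E" for e
        using t that by (auto simp: B_def E'_def x_def)
      have gen3: "on_line P d (U i) (V i) \<or> area2 (U i) (V i) x \<noteq> 0"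
          "on_line P d (V i) (W i) \<or> area2 (V i) (W i) x \<noteq> 0"
          "on_line P d (W i) (U i) \<or> area2 (W i) (U i) x \<noteq> 0" if "i \<in> K" for i
        using gen[of "(i, 0)"] gen[of "(i, 1)"] gen[of "(i, 2)"] that unfolding edge
        by (simp_all add: E_def)
      let ?tr = "\<lambda>i. edge_trace P d (U i) (V i) t + edge_trace P d (V i) (W i) t + edge_trace P d (W i) (U i) t"
      have jump: "\<forall>\<^sub>F \<epsilon> in at_right 0. \<forall>i\<in>K. side_jump (U i) (V i) (W i) d x \<epsilon> = ?tr i"
        using K side_jump_eq_edge_traces[OF D d x_def gen3] by (simp add: eventually_ball_finite)
      have "\<forall>\<^sub>F \<epsilon> in at_right 0. off_edges (U i) (V i) (W i) (x + \<epsilon> *\<^sub>R normal d) \<and>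
          off_edges (U i) (V i) (W i) (x + \<epsilon> *\<^sub>R normal (- d))" if i: "i \<in> K" for i
        using eventually_off_line[OF d x_def ne(1)[OF i] gen3(1)[OF i]]
          eventually_off_line[OF d x_def ne(2)[OF i] gen3(2)[OF i]]
          eventually_off_line[OF d x_def ne(3)[OF i] gen3(3)[OF i]]
        by eventually_elim (simp add: off_edges_def)
      then have "\<forall>\<^sub>F \<epsilon> in at_right 0. \<forall>i\<in>K. off_edges (U i) (V i) (W i) (x + \<epsilon> *\<^sub>R normal d) \<and>
          off_edges (U i) (V i) (W i) (x + \<epsilon> *\<^sub>R normal (- d))"
        using K by (simp add: eventually_ball_finite)
      with jump have "\<forall>\<^sub>F \<epsilon> in at_right (0::real). (\<Sum>i\<in>K. c i * ?tr i) = 0"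
      proof eventually_elim
        case (elim \<epsilon>)
        have "(\<Sum>i\<in>K. c i * ?tr i) = (\<Sum>i\<in>K. c i * side_jump (U i) (V i) (W i) d x \<epsilon>)"
          using elim(1) by (intro sum.cong) auto
        also have "\<dots> = (\<Sum>i\<in>K. c i * of_bool (in_open_triangle (U i) (V i) (W i) (x + \<epsilon> *\<^sub>R normal d))) -
            (\<Sum>i\<in>K. c i * of_bool (in_open_triangle (U i) (V i) (W i) (x + \<epsilon> *\<^sub>R normal (- d))))"
          by (simp only: right_diff_distrib sum_subtractf)
        also have "\<dots> = 0"
          using zero[of "x + \<epsilon> *\<^sub>R normal d"] zero[of "x + \<epsilon> *\<^sub>R normal (- d)"] elim(2) by simp
        finally show ?case .
      qed
      then have "(\<Sum>i\<in>K. c i * ?tr i) = 0" by simp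
      then have "(\<Sum>e\<in>E. C e * edge_trace P d (src e) (tgt e) t) = 0"
        by (subst sumE[of "\<lambda>a b. edge_trace P d a b t"])
      moreover have "(\<Sum>e\<in>E'. C e * signed_seg (param P d (src e)) (param P d (tgt e)) t) =
          (\<Sum>e\<in>E. C e * edge_trace P d (src e) (tgt e) t)"
        unfolding E'_def using finE
        by (intro sum.mono_neutral_cong_left) (auto simp: edge_trace_def)
      ultimately show ?thesis by simp
    qed
    have "(\<Sum>e\<in>E'. C e * (\<phi> P (P + param P d (tgt e) *\<^sub>R d) - \<phi> P (P + param P d (src e) *\<^sub>R d))) = 0"
      using signed_segments_telescope[OF _ finB trace, of "\<lambda>\<tau>. \<phi> P (P + \<tau> *\<^sub>R d)"] finE
      by (simp add: E'_def)
    \<comment> \<open>With \<open>P\<close> as base point, additivity along the line gives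
      \<open>\<phi>\<close> the primitive \<open>\<phi> P\<close>.\<close>
    moreover have "\<phi> (src e) (tgt e) =
        \<phi> P (P + param P d (tgt e) *\<^sub>R d) - \<phi> P (P + param P d (src e) *\<^sub>R d)" if "e \<in> E'" for e
    proof -
      have L: "src e \<in> line P d" "tgt e \<in> line P d" using that by (auto simp: E'_def on_line_def)
      have "P \<in> line P d" using d by (simp add: mem_line_iff param_def)
      then have "\<phi> P (tgt e) = \<phi> P (src e) + \<phi> (src e) (tgt e)"
        by (intro additive area2_eq_zero_on_line[of _ P d] L)
      then show ?thesis using L d by (simp flip: mem_line_iff add: mem_line_iff[THEN iffD1, symmetric])
    qed
    ultimately have "(\<Sum>e\<in>E'. C e * \<phi> (src e) (tgt e)) = 0" by simp
    then show ?thesis by (simp add: E'_def)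
  qed
  define ln where "ln e = line (src e) (tgt e - src e)" for e
  have "(\<Sum>e\<in>E. C e * \<phi> (src e) (tgt e)) = (\<Sum>L\<in>ln ` E. \<Sum>e\<in>{e \<in> E. ln e = L}. C e * \<phi> (src e) (tgt e))"
    by (rule sum.image_gen[OF finE])
  also have "\<dots> = 0"
  proof (rule sum.neutral, rule ballI)
    fix L assume "L \<in> ln ` E"
    then obtain e0 where e0: "e0 \<in> E" "L = ln e0" by blast
    have "{e \<in> E. ln e = L} = {e \<in> E. on_line (src e0) (tgt e0 - src e0) (src e) (tgt e)}"
      unfolding e0(2) ln_def on_line_def
      by (intro Collect_cong conj_cong refl) (rule line_eq_iff[OF neE])
    then show "(\<Sum>e\<in>{e \<in> E. ln e = L}. C e * \<phi> (src e) (tgt e)) = 0"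
      using on_one_line[of "tgt e0 - src e0" "src e0"] neE[OF e0(1)] by simp
  qed
  finally show ?thesis unfolding sumE .
qed

section \<open>Dissections\<close>

text \<open>The third colour is neither \<open>A\<close> nor \<open>B\<close>. On points that miss a
  colour, \<open>\<phi> u v\<close> is 0 if \<open>A\<close> or \<open>B\<close> is missing, and
  otherwise the indicator of \<open>B\<close> at \<open>v\<close> minus that at \<open>u\<close>.
  Such differences add up and cancel around a cycle.\<close>

lemma signed_count_additive:
  fixes A B :: "'p \<Rightarrow> bool"
  defines "\<phi> \<equiv> \<lambda>u v. of_bool (A u \<and> B v) - of_bool (B u \<and> A v) :: real"
  assumes disj: "\<And>z. \<not> (A z \<and> B z)"
    and "\<not> ((\<exists>a\<in>{u, v, w}. A a) \<and> (\<exists>b\<in>{u, v, w}. B b) \<and> (\<exists>c\<in>{u, v, w}. \<not> A c \<and> \<not> B c))"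
  shows "\<phi> u w = \<phi> u v + \<phi> v w" and "\<phi> u v + \<phi> v w + \<phi> w u = 0"
  using assms(3) disj[of u] disj[of v] disj[of w] unfolding \<phi>_def
  by (cases "A u"; cases "A v"; cases "A w"; cases "B u"; cases "B v"; cases "B w"; simp)+

text \<open>A point of the quadrilateral is on the left of all four edges, and the sign of
  \<open>area2 q s z\<close> tells on which side of the diagonal it is.\<close>

lemma mem_quadrilateral_iff:
  assumes Q: "ccw_quadrilateral p q r s" and z: "area2 q s z \<noteq> 0"
  shows "z \<in> convex hull {p, q, r, s} \<longleftrightarrow> z \<in> convex hull {p, q, s} \<or> z \<in> convex hull {q, r, s}"
proof
  have pos: "area2 p q r > 0" "area2 q r s > 0" "area2 r s p > 0" "area2 s p q > 0"
    using Q by (simp_all add: ccw_quadrilateral_def ccw_def area2_def)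
  then have pos': "area2 p q s > 0" "area2 q r p > 0" "area2 r s q > 0" "area2 s p r > 0"
    by (simp_all add: area2_def algebra_simps)
  assume T: "z \<in> convex hull {p, q, r, s}"
  have *: "area2 a b z \<ge> 0" if "\<forall>y\<in>{p, q, r, s}. area2 a b y \<ge> 0" for a b
    using hull_minimal[of "{p, q, r, s}" "{z. area2 a b z \<ge> 0}" convex] convex_area2[of a b] T that by auto
  have "area2 p q z \<ge> 0" "area2 q r z \<ge> 0" "area2 r s z \<ge> 0" "area2 s p z \<ge> 0"
    using pos pos' by (auto intro!: *)
  moreover have "area2 s q z = - area2 q s z" by (rule area2_swap)
  ultimately show "z \<in> convex hull {p, q, s} \<or> z \<in> convex hull {q, r, s}"
    unfolding mem_triangle_iff[OF pos'(1)] mem_triangle_iff[OF pos(2)] by linarith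
next
  assume "z \<in> convex hull {p, q, s} \<or> z \<in> convex hull {q, r, s}"
  then show "z \<in> convex hull {p, q, r, s}"
    using hull_mono[of "{p, q, s}" "{p, q, r, s}" convex] hull_mono[of "{q, r, s}" "{p, q, r, s}" convex]
    by blast
qed

lemma mem_triangle_iff_open:
  assumes "area2 u v w > 0" "off_edges u v w z"
  shows "z \<in> convex hull {u, v, w} \<longleftrightarrow> in_open_triangle u v w z"
  using assms(2) unfolding mem_triangle_iff[OF assms(1)] by (auto simp: in_open_triangle_def off_edges_def)

lemma is_triangle_orientedE:
  assumes "is_triangle \<Delta>"
  obtains u v w where "area2 u v w > 0" "\<Delta> = convex hull {u, v, w}"
proof -
  obtain u v w where t: "area2 u v w \<noteq> 0" "\<Delta> = convex hull {u, v, w}"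
    using assms unfolding is_triangle_def area2_eq_zero_iff_collinear by blast
  show thesis
  proof (cases "area2 u v w > 0")
    case False
    then have "area2 v u w > 0" using t(1) area2_swap[of v u w] by simp
    then show ?thesis using that t(2) by (simp add: insert_commute)
  qed (use t that in blast)
qed

text \<open>The pieces get weight 1 and the halves \<open>pqs\<close> and \<open>qrs\<close> weight
  -1. Off all edge lines a point of the quadrilateral is in exactly one piece and exactly one half,
  so the weighted count is 0; the two passages of the diagonal cancel.\<close>

lemma dissection_boundary_sum:
  assumes Q: "ccw_quadrilateral p q r s"
    and diss: "dissection (convex hull {p, q, r, s}) n \<Delta>"
    and tri: "\<And>i. i \<in> {1..n} \<Longrightarrow> area2 (u i) (v i) (w i) > 0"
      "\<And>i. i \<in> {1..n} \<Longrightarrow> \<Delta> i = convex hull {u i, v i, w i}"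
    and additive: "\<And>u v w. area2 u v w = 0 \<Longrightarrow> \<phi> u w = \<phi> u v + \<phi> v w"
  shows "(\<Sum>i\<in>{1..n}. \<phi> (u i) (v i) + \<phi> (v i) (w i) + \<phi> (w i) (u i)) =
    \<phi> p q + \<phi> q r + \<phi> r s + (\<phi> s p :: real)"
proof -
  \<comment> \<open>The pieces use the indices from 1 to \<open>n\<close>, which leaves 0 and
    \<open>Suc n\<close> for the two halves.\<close>
  define K where "K = insert 0 (insert (Suc n) {1..n})"
  define U where "U = u(0 := p, Suc n := q)"
  define V' where "V' = v(0 := q, Suc n := r)"
  define W where "W = w(0 := s, Suc n := s)"
  define c :: "nat \<Rightarrow> real" where "c i = (if i \<in> {1..n} then 1 else -1)" for i
  have pos: "area2 p q s > 0" "area2 q r s > 0"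
    using Q area2_rotate[of p q s] by (simp_all add: ccw_quadrilateral_def ccw_def flip: area2_def)
  have split: "(\<Sum>i\<in>K. c i * F (U i) (V' i) (W i)) =
      (\<Sum>i\<in>{1..n}. F (u i) (v i) (w i)) - F p q s - F q r s" for F
  proof -
    have "(\<Sum>i\<in>{1..n}. c i * F (U i) (V' i) (W i)) = (\<Sum>i\<in>{1..n}. F (u i) (v i) (w i))"
      by (intro sum.cong) (auto simp: c_def U_def V'_def W_def)
    then show ?thesis by (simp add: K_def c_def) (simp add: U_def V'_def W_def)
  qed
  have "(\<Sum>i\<in>K. c i * (\<phi> (U i) (V' i) + \<phi> (V' i) (W i) + \<phi> (W i) (U i))) = 0"
  proof (rule boundary_sum_eq_zero[OF _ _ additive])
    show "area2 (U i) (V' i) (W i) > 0" if "i \<in> K" for i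
      using that pos tri(1) by (auto simp: K_def U_def V'_def W_def)
    fix z assume off: "\<And>i. i \<in> K \<Longrightarrow> off_edges (U i) (V' i) (W i) z"
    have off': "off_edges p q s z" "off_edges q r s z"
      using off[of 0] off[of "Suc n"] by (simp_all add: K_def U_def V'_def W_def)
    have off_i: "off_edges (u i) (v i) (w i) z" if "i \<in> {1..n}" for i
      using off[of i] that by (simp add: K_def U_def V'_def W_def)
    have mem: "z \<in> \<Delta> i \<longleftrightarrow> in_open_triangle (u i) (v i) (w i) z" if "i \<in> {1..n}" for i
      using mem_triangle_iff_open[OF tri(1) off_i] tri(2) that by simp
    \<comment> \<open>Off the edge lines, membership in a piece means membership in its interior, so
      the disjointness of interiors applies.\<close>
    have int: "z \<in> interior (\<Delta> i)" if "i \<in> {1..n}" "z \<in> \<Delta> i" for i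
      using in_open_triangle_imp_interior[OF tri(1)] tri(2) mem that by simp
    have disjoint: "i = j" if "i \<in> {1..n}" "z \<in> \<Delta> i" "j \<in> {1..n}" "z \<in> \<Delta> j" for i j
      using diss int[of i] int[of j] that unfolding dissection_def by blast
    have "(\<Sum>i\<in>{1..n}. of_bool (in_open_triangle (u i) (v i) (w i) z)) = (\<Sum>i\<in>{1..n}. of_bool (z \<in> \<Delta> i) :: real)"
      by (intro sum.cong) (simp_all add: mem)
    also have "\<dots> = of_bool (z \<in> convex hull {p, q, r, s})"
    proof (cases "z \<in> convex hull {p, q, r, s}")
      case True
      then obtain j where j: "j \<in> {1..n}" "z \<in> \<Delta> j" using diss unfolding dissection_def by blast
      have "(\<Sum>i\<in>{1..n}. of_bool (z \<in> \<Delta> i) :: real) = (\<Sum>i\<in>{1..n}. of_bool (i = j))"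
        using disjoint j by (intro sum.cong) auto
      also have "\<dots> = 1" using j(1) by (simp add: of_bool_def)
      finally show ?thesis using True by simp
    next
      case False
      then show ?thesis using diss unfolding dissection_def by (intro trans[OF sum.neutral]) auto
    qed
    also have "\<dots> = of_bool (in_open_triangle p q s z) + of_bool (in_open_triangle q r s z)"
    proof -
      have "area2 q s z \<noteq> 0" using off' by (simp add: off_edges_def)
      moreover have "\<not> (in_open_triangle p q s z \<and> in_open_triangle q r s z)"
        using area2_swap[of q s z] by (auto simp: in_open_triangle_def)
      ultimately show ?thesis
        unfolding mem_quadrilateral_iff[OF Q \<open>area2 q s z \<noteq> 0\<close>] mem_triangle_iff_open[OF pos(1) off'(1)]
          mem_triangle_iff_open[OF pos(2) off'(2)] by auto
    qed
    finally show "(\<Sum>i\<in>K. c i * of_bool (in_open_triangle (U i) (V' i) (W i) z)) = 0"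
      unfolding split[of "\<lambda>a b c. of_bool (in_open_triangle a b c z)"] by simp
  qed (simp add: K_def)
  then have "(\<Sum>i\<in>{1..n}. \<phi> (u i) (v i) + \<phi> (v i) (w i) + \<phi> (w i) (u i)) =
      \<phi> p q + \<phi> q s + \<phi> s p + (\<phi> q r + \<phi> r s + \<phi> s q)"
    unfolding split[of "\<lambda>a b c. \<phi> a b + \<phi> b c + \<phi> c a"] by simp
  \<comment> \<open>The triple \<open>q, q, q\<close> gives \<open>\<phi> q q = 0\<close>, and
    \<open>q, s, q\<close> then gives the claim.\<close>
  moreover have "\<phi> q s + \<phi> s q = 0"
    using additive[of q s q] additive[of q q q] by simp
  ultimately show ?thesis by simp
qed

lemma collinear_zero_iff: "collinear {0, x, y} \<longleftrightarrow> x$1 * y$2 = x$2 * (y$1 :: real)" for x y :: "real^2"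
  by (simp add: area2_def flip: area2_eq_zero_iff_collinear)

theorem theorem1:
  fixes p q r s :: "real^2" and n :: nat
    and \<Delta> :: "nat \<Rightarrow> (real^2) set" and a :: "nat \<Rightarrow> real"
  assumes "ccw_trapezoid p q r s"
    and "dissection (convex hull {p, q, r, s}) n \<Delta>"
    and "\<And>i. i \<in> {1..n} \<Longrightarrow> a i = measure lebesgue (\<Delta> i)"
  shows "integral_over (is_subring hull (a ` {1..n})) (measure lebesgue (convex hull {p, q, s}))"
proof (rule ccontr)
  define D where "D = area2 p q s"
  have Q: "ccw_quadrilateral p q r s" using assms(1) by (simp add: ccw_trapezoid_def)
  then have D: "D > 0"
    using area2_rotate[of p q s] by (simp add: D_def ccw_quadrilateral_def ccw_def flip: area2_def)
  assume "\<not> ?thesis"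
  then obtain V where V: "valuation_ring V" "is_subring hull (a ` {1..n}) \<subseteq> V"
      "measure lebesgue (convex hull {p, q, s}) \<notin> V"
    using ex_valuation_ring_avoiding[OF is_subring_hull] by blast
  have aV: "a i \<in> V" if "i \<in> {1..n}" for i 
    using V(2) hull_subset[of "a ` {1..n}" is_subring] that by blast
  have DV: "D / 2 \<notin> V" using V(3) D by (simp add: measure_triangle D_def)
  have one_not_le_zero: "val_less V 0 1" using val_le_zero_iff[OF V(1)] by simp
  \<comment> \<open>The affine coordinates with \<open>p = (0,0)\<close>, \<open>q = (1,0)\<close>,
    \<open>s = (0,1)\<close>, as ratios of areas.\<close>
  define X where "X z = area2 p z s / D" for z
  define Y where "Y z = area2 p q z / D" for z
  \<comment> \<open>Colour \<open>A\<close> is where 1 strictly dominates, \<open>B\<close> where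
    \<open>X\<close> dominates (ties included), and the remaining colour is where \<open>Y\<close>
    does.\<close>
  define A where "A z \<longleftrightarrow> val_less V (X z) 1 \<and> val_less V (Y z) 1" for z
  define B where "B z \<longleftrightarrow> val_le V 1 (X z) \<and> val_le V (Y z) (X z)" for z
  have disj: "\<not> (A z \<and> B z)" for z by (auto simp: A_def B_def)
  define rainbow where "rainbow S \<longleftrightarrow> (\<exists>a\<in>S. A a) \<and> (\<exists>b\<in>S. B b) \<and> (\<exists>c\<in>S. \<not> A c \<and> \<not> B c)" for S
  define \<phi> where "\<phi> u v = (of_bool (A u \<and> B v) - of_bool (B u \<and> A v) :: real)" for u v
  have rainbow_area: "val_le V 1 (area2 u v w / D)" if "rainbow {u, v, w}" for u v w
  proof -
    obtain a b c where abc: "a \<in> {u, v, w}" "b \<in> {u, v, w}" "c \<in> {u, v, w}"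
        "A a" "B b" "\<not> A c" "\<not> B c"
      using \<open>rainbow {u, v, w}\<close> unfolding rainbow_def by blast
    then have distinct: "a \<noteq> b" "a \<noteq> c" "b \<noteq> c" using disj by auto
    have C: "val_le V 1 (Y c)" "val_less V (X c) (Y c)"
      using abc(6,7) val_le_total[OF V(1)] val_le_trans[OF V(1)] unfolding A_def B_def by blast+
    \<comment> \<open>The change of coordinates divides every \<open>area2\<close> by its value
      \<open>D\<close> on \<open>pqs\<close>.\<close>
    have "(X b - X a) * (Y c - Y a) - (Y b - Y a) * (X c - X a) = area2 a b c / D"
    proof -
      have "(area2 p b s - area2 p a s) * (area2 p q c - area2 p q a) -
          (area2 p q b - area2 p q a) * (area2 p c s - area2 p a s) = area2 a b c * area2 p q s"
        by (simp add: area2_def algebra_simps)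
      then show ?thesis
        unfolding X_def Y_def diff_divide_distrib[symmetric] times_divide_times_eq
        using D by (simp add: D_def)
    qed
    then have le: "val_le V 1 (area2 a b c / D)"
      using rainbow_determinant[OF V(1), of "X a" "Y a" "X b" "Y b" "Y c" "X c"] abc(4,5) C
      unfolding A_def B_def by metis
    have "area2 a b c = area2 u v w \<or> area2 a b c = - area2 u v w"
      using abc(1-3) distinct by (auto simp: area2_def algebra_simps)
    then show ?thesis
      using le val_le_uminus[OF V(1) le] by auto
  qed
  have total: "(\<Sum>i\<in>{1..n}. \<phi> (u i) (v i) + \<phi> (v i) (w i) + \<phi> (w i) (u i)) =
      \<phi> p q + \<phi> q r + \<phi> r s + \<phi> s p"
    if "\<And>i. i \<in> {1..n} \<Longrightarrow> area2 (u i) (v i) (w i) > 0"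
      "\<And>i. i \<in> {1..n} \<Longrightarrow> \<Delta> i = convex hull {u i, v i, w i}" for u v w
  proof (rule dissection_boundary_sum[OF Q assms(2) that])
    fix u v w assume "area2 u v w = 0"
    then have "\<not> rainbow {u, v, w}"
      using rainbow_area[of u v w] one_not_le_zero by auto
    then show "\<phi> u w = \<phi> u v + \<phi> v w"
      unfolding \<phi>_def by (intro signed_count_additive(1) disj) (simp add: rainbow_def)
  qed
  have "\<forall>i\<in>{1..n}. \<exists>u v w. area2 u v w > 0 \<and> \<Delta> i = convex hull {u, v, w}"
    using assms(2) is_triangle_orientedE unfolding dissection_def by metis
  then obtain u v w where uvw: "\<And>i. i \<in> {1..n} \<Longrightarrow> area2 (u i) (v i) (w i) > 0"
      "\<And>i. i \<in> {1..n} \<Longrightarrow> \<Delta> i = convex hull {u i, v i, w i}"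
    by metis
  have zero: "\<phi> (u i) (v i) + \<phi> (v i) (w i) + \<phi> (w i) (u i) = 0" if i: "i \<in> {1..n}" for i
  proof -
    have "\<not> rainbow {u i, v i, w i}"
    proof
      assume "rainbow {u i, v i, w i}"
      then obtain c where c: "c \<in> V" "1 = c * (area2 (u i) (v i) (w i) / D)"
        using rainbow_area unfolding val_le_def by blast
      \<comment> \<open>A rainbow piece would make the area \<open>D / 2\<close> of
        \<open>pqs\<close> a multiple of \<open>a i\<close> in \<open>V\<close>.\<close>
      then have "D / 2 = c * (area2 (u i) (v i) (w i) / 2)" using D by (simp add: field_simps)
      also have "area2 (u i) (v i) (w i) / 2 = a i"
        using assms(3)[OF i] uvw[OF i] by (simp add: measure_triangle)
      finally show False
        using DV c(1) aV[OF i] V(1) is_subring_mult unfolding valuation_ring_def by metis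
    qed
    then show ?thesis
      unfolding \<phi>_def by (intro signed_count_additive(2) disj) (simp add: rainbow_def)
  qed
  have "\<phi> p q + \<phi> q r + \<phi> r s + \<phi> s p = 0"
  proof -
    have "(\<Sum>i\<in>{1..n}. \<phi> (u i) (v i) + \<phi> (v i) (w i) + \<phi> (w i) (u i)) = 0"
      using zero by (intro sum.neutral ballI)
    then show ?thesis using total[of u v w] uvw by metis
  qed
  moreover have "A p" "B q" "\<not> A s" "\<not> B s"
    using D val_le_refl[OF V(1)] val_le_zero_iff[OF V(1)] is_subring_zero V(1)
    by (auto simp: A_def B_def X_def Y_def val_le_def valuation_ring_def D_def)
  \<comment> \<open>This is where the trapezoid enters: \<open>r\<close> is as far from
    \<open>pq\<close> as \<open>s\<close>, or as far from \<open>ps\<close> as \<open>q\<close>, so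
    \<open>Y r = 1\<close> or \<open>X r = 1\<close>.\<close>
  moreover have "\<not> A r"
  proof -
    have "parallel (q - p) (r - s) \<or> parallel (r - q) (s - p)"
      using assms(1) by (simp add: ccw_trapezoid_def)
    then have "area2 p q r = D \<or> area2 p r s = D"
      unfolding parallel_def collinear_zero_iff by (auto simp: D_def area2_def algebra_simps)
    then show ?thesis using D val_le_refl[OF V(1)] by (auto simp: A_def X_def Y_def)
  qed
  \<comment> \<open>Edge \<open>pq\<close> counts 1. The edges \<open>qr\<close> and
    \<open>rs\<close> have no end of colour \<open>A\<close>, and \<open>sp\<close> has none of
    colour \<open>B\<close>, so the sum is 1 and not 0.\<close>
  ultimately show False using disj[of p] disj[of q] by (simp add: \<phi>_def)
qed

end
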